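(* Let $s=(12)$ and $t=(23)$ in the symmetric group $S_3$. The multiset $A=\{s,s,t,t,t,t\}$ (two copies of $s$ and four copies of $t$) satisfies the abelianization obstruction and admits an ordering of its elements whose product is $1$ in $S_3$.
   Context: All multisets are counted with multiplicity. Abelianization obstruction: for a finite group $G$ with canonical projection $\pi:G\to G_{\mathrm{ab}}=G/[G,G]$, a multiset $A$ in $G$ satisfies the abelianization obstruction if $\prod_{a\in A}\pi(a)=1$ in $G_{\mathrm{ab}}$, the product being taken with multiplicity (independent of order since $G_{\mathrm{ab}}$ is abelian). Permutations in $S_3$ are composed from right to left. *)

theory Defs
  imports "HOL-Algebra.Sym_Groups" "HOL-Algebra.FiniteProduct" "HOL-Library.Multiset"
begin

definition abelianization :: "('a, 'b) monoid_scheme \<Rightarrow> 'a set monoid"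
  where "abelianization G = G Mod (derived G (carrier G))"

definition abel_proj :: "('a, 'b) monoid_scheme \<Rightarrow> 'a \<Rightarrow> 'a set"
  where "abel_proj G g = derived G (carrier G) #>\<^bsub>G\<^esub> g"

text \<open>The product with multiplicity is taken over the distinct elements of the multiset, each
  contributing the power given by its multiplicity. It is meaningful when \<open>G\<close> is a group, since
  then the abelianization is a commutative group (\<open>group.derived_quot_is_comm_group\<close>).\<close>

definition abelianization_obstruction :: "('a, 'b) monoid_scheme \<Rightarrow> 'a multiset \<Rightarrow> bool"
  where "abelianization_obstruction G A \<longleftrightarrow>
    set_mset A \<subseteq> carrier G \<and>
    finprod (abelianization G)
      (\<lambda>a. abel_proj G a [^]\<^bsub>abelianization G\<^esub> count A a) (set_mset A)
      = \<one>\<^bsub>abelianization G\<^esub>"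

end

theory Submission
  imports Defs
begin

text \<open>Both transpositions are involutions, and each occurs an even number of times in
  \<open>A\<close>. An even power of an involution is trivial already in the group, hence also after
  projection, so every factor of the product over the distinct elements is 1: this is
  \<open>abelianization_obstruction_even_involutions\<close>, valid in any group. For the ordering,
  keep equal elements adjacent, so that the word s s t t t t cancels in pairs.\<close>

lemma (in group) abelianization_comm_group: "comm_group (abelianization G)"
  unfolding abelianization_def by (rule derived_quot_is_comm_group)

lemma (in group) abel_proj_hom: "abel_proj G \<in> hom G (abelianization G)"
  unfolding abelianization_def abel_proj_def[abs_def]
  using normal.r_coset_hom_Mod[OF derived_self_is_normal] .

text \<open>The projection is a homomorphism, so the power can be taken in \<open>G\<close> first,
  where it is a power of \<open>a [^] 2\<close>, which is 1.\<close>

lemma (in group) abel_proj_involution_pow_even: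
  assumes "a \<in> carrier G" "a \<otimes> a = \<one>" "even (n::nat)"
  shows "abel_proj G a [^]\<^bsub>abelianization G\<^esub> n = \<one>\<^bsub>abelianization G\<^esub>"
proof -
  interpret Ab: comm_group "abelianization G" by (rule abelianization_comm_group)
  interpret pr: group_hom G "abelianization G" "abel_proj G"
    by unfold_locales (rule abel_proj_hom)
  obtain k where n: "n = 2 * k" using assms(3) by blast
  have "a [^] n = (a [^] (2::nat)) [^] k"
    unfolding n using assms(1) by (simp only: nat_pow_pow)
  also have "\<dots> = \<one>"
    using assms(1,2) by (simp add: numeral_2_eq_2)
  finally have "a [^] n = \<one>" .
  then show ?thesis
    using assms(1) by (metis pr.hom_nat_pow pr.hom_one)
qed

lemma (in group) abelianization_obstruction_even_involutions:
  assumes "\<And>a. a \<in># A \<Longrightarrow> a \<in> carrier G \<and> a \<otimes> a = \<one> \<and> even (count A a)"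
  shows "abelianization_obstruction G A"
proof -
  interpret Ab: comm_group "abelianization G" by (rule abelianization_comm_group)
  show ?thesis
    unfolding abelianization_obstruction_def
    \<comment> \<open>The product is trivial factor by factor; no cancellation between different
      elements is involved.\<close>
    by (intro conjI subsetI Ab.finprod_one_eqI abel_proj_involution_pow_even)
      (use assms in blast)+
qed

theorem proposition5p4:
  fixes s t :: "nat \<Rightarrow> nat" and A :: "(nat \<Rightarrow> nat) multiset"
  assumes "s = transpose 1 2" and "t = transpose 2 3"
    and "A = {#s, s, t, t, t, t#}"
  shows "abelianization_obstruction (sym_group 3) A \<and>
    (\<exists>xs. mset xs = A \<and>
      foldr (\<otimes>\<^bsub>sym_group 3\<^esub>) xs \<one>\<^bsub>sym_group 3\<^esub> = \<one>\<^bsub>sym_group 3\<^esub>)"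
proof
  interpret S3: group "sym_group 3" by (rule sym_group_is_group)
  have "s permutes {1..3}" "t permutes {1..3}"
    unfolding assms(1,2) by (auto intro: permutes_swap_id)
  then have carr: "s \<in> carrier (sym_group 3)" "t \<in> carrier (sym_group 3)"
    by (simp_all add: sym_group_carrier)
  have sq: "s \<circ> s = id" "t \<circ> t = id"
    unfolding assms(1,2) by simp_all
  \<comment> \<open>The point 1 is moved by \<open>s\<close> and fixed by \<open>t\<close>.
    Distinctness makes the multiplicities in \<open>A\<close> evaluate to 2 and 4.\<close>
  have "s 1 \<noteq> t 1" unfolding assms(1,2) by (simp add: transpose_def)
  then have "s \<noteq> t" by metis
  then show "abelianization_obstruction (sym_group 3) A"
    using carr sq
    by (intro S3.abelianization_obstruction_even_involutions)
      (auto simp: assms(3) sym_group_mult sym_group_one)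
  have "foldr (\<otimes>\<^bsub>sym_group 3\<^esub>) [s, s, t, t, t, t] \<one>\<^bsub>sym_group 3\<^esub> = \<one>\<^bsub>sym_group 3\<^esub>"
    \<comment> \<open>The fold nests to the right, so the word collapses from its right end: two
      pairs of \<open>t\<close>, then the pair of \<open>s\<close>.\<close>
    using sq by (simp add: sym_group_mult sym_group_one)
  then show "\<exists>xs. mset xs = A \<and>
      foldr (\<otimes>\<^bsub>sym_group 3\<^esub>) xs \<one>\<^bsub>sym_group 3\<^esub> = \<one>\<^bsub>sym_group 3\<^esub>"
    using assms(3) by (metis mset.simps)
qed

end
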